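(* Let $\mathbb H=(V,\mathcal H)$ be a connected hypergraph. Suppose that there exists a subset $B\subset V$ such that: (1) all hyperedges of $\mathcal H(B)=\{H\in\mathcal H: H\cap B\ne\emptyset\}$ contain at least one node of degree $1$; (2) at least one of these nodes of degree $1$ (belonging to hyperedges of $\mathcal H(B)$) lies outside of $B$. Then $\mathbb H$ is non-stabilizable.
   Context: A hypergraph $\mathbb H=(V,\mathcal H)$ consists of a finite node set $V$ and a finite set $\mathcal H$ of subsets of $V$ (hyperedges) with union $V$. All hypergraphs are assumed simple (no hyperedge is contained in another one) and connected (the graph whose vertices are the hyperedges, with two hyperedges adjacent when they intersect, is connected). The degree of a node is the number of hyperedges containing it. $\mathscr M(V)$ is the set of probability measures $\mu$ on $V$ with $\mu(i)>0$ for all $i$. Matching model $(\mathbb H,\Phi,\mu)$: at each time $n\ge1$ one item enters; its class $C_n\in V$ is drawn from $\mu$, i.i.d. If the buffer contains a set of items whose classes form, together with $C_n$, a hyperedge (one item per class), the policy $\Phi$ selects one such set and these items leave immediately together with the incoming item (a match is always performed whenever possible); otherwise the incoming item is stored. $W_n$ is the word over $V$ listing the classes of unmatched items after the arrival at time $n$, in order of arrival; it takes values in the set of words in which, for each hyperedge, some class of the hyperedge does not occur. $\Phi$ is admissible if the choice of the match depends solely on the queue detail (the word) upon arrival and the incoming class, and possibly on an independent uniform draw in case of a tie; then $(W_n)$ is a Markov chain. The model is stable if $(W_n)$ is positive recurrent; $\mathrm{Stab}(\mathbb H,\Phi)$ is the set of $\mu\in\mathscr M(V)$ for which it is stable. $\mathbb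 H$ is non-stabilizable if $\mathrm{Stab}(\mathbb H,\Phi)=\emptyset$ for every admissible $\Phi$. *)

theory Defs
  imports "HOL-Probability.Probability"
begin

section \<open>Hypergraphs\<close>

definition hypergraph :: "'v set \<Rightarrow> 'v set set \<Rightarrow> bool" where
  "hypergraph V \<H> \<longleftrightarrow> finite V \<and> finite \<H> \<and> \<H> \<subseteq> Pow V \<and> \<Union>\<H> = V"

definition simple_hypergraph :: "'v set set \<Rightarrow> bool" where
  "simple_hypergraph \<H> \<longleftrightarrow> (\<forall>h\<in>\<H>. \<forall>h'\<in>\<H>. h \<subseteq> h' \<longrightarrow> h = h')"

definition connected_hypergraph :: "'v set set \<Rightarrow> bool" where
  "connected_hypergraph \<H> \<longleftrightarrow>
     (\<forall>h\<in>\<H>. \<forall>h'\<in>\<H>. (h, h') \<in> {(a, b). a \<in> \<H> \<and> b \<in> \<H> \<and> a \<inter> b \<noteq> {}}\<^sup>*)"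

definition node_degree :: "'v set set \<Rightarrow> 'v \<Rightarrow> nat" where
  "node_degree \<H> i = card {h \<in> \<H>. i \<in> h}"

definition hyperedges_meeting :: "'v set set \<Rightarrow> 'v set \<Rightarrow> 'v set set" where
  "hyperedges_meeting \<H> B = {h \<in> \<H>. h \<inter> B \<noteq> {}}"


section \<open>The matching model\<close>

definition queue_details :: "'v set \<Rightarrow> 'v set set \<Rightarrow> 'v list set" where
  "queue_details V \<H> = {w \<in> lists V. \<forall>h\<in>\<H>. \<not> h \<subseteq> set w}"

text \<open>A set of stored items is given by the set of their positions in the queue detail.
  The classes of the selected items are pairwise distinct, differ from the incoming
  class \<open>c\<close>, and form a hyperedge together with \<open>c\<close>.\<close>

definition possible_matches :: "'v set set \<Rightarrow> 'v list \<Rightarrow> 'v \<Rightarrow> nat set set" where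
  "possible_matches \<H> w c =
     {S. S \<subseteq> {..<length w} \<and> inj_on ((!) w) S \<and> c \<notin> (!) w ` S \<and> insert c ((!) w ` S) \<in> \<H>}"

text \<open>A policy selects the stored items to be matched, as a function of the queue detail,
  the incoming class and the value of an auxiliary uniform draw (which it is free to ignore).
  Its value is irrelevant when no match is possible.\<close>

type_synonym 'v policy = "'v list \<Rightarrow> 'v \<Rightarrow> real \<Rightarrow> nat set"

text \<open>The function space in this definition means both that \<open>\<Phi> w c u\<close> is a possible match
  for every \<open>u\<close> and that it depends measurably on \<open>u\<close>.\<close>

definition admissible :: "'v set \<Rightarrow> 'v set set \<Rightarrow> 'v policy \<Rightarrow> bool" where
  "admissible V \<H> \<Phi> \<longleftrightarrow>
     (\<forall>w\<in>queue_details V \<H>. \<forall>c\<in>V. possible_matches \<H> w c \<noteq> {} \<longrightarrow>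
        \<Phi> w c \<in> borel \<rightarrow>\<^sub>M count_space (possible_matches \<H> w c))"

definition arrival_step :: "'v set set \<Rightarrow> 'v policy \<Rightarrow> 'v list \<Rightarrow> 'v \<times> real \<Rightarrow> 'v list" where
  "arrival_step \<H> \<Phi> w = (\<lambda>(c, u).
     if possible_matches \<H> w c = {} then w @ [c] else nths w (- \<Phi> w c u))"

text \<open>\<open>queue_process \<H> \<Phi> w n \<omega>\<close> is $W_n$ for the initial state $W_0 = w$; the pair
  \<open>\<omega> !! n\<close> consists of the class and the uniform draw of the item entering at time
  \<open>Suc n\<close>.\<close>

primrec queue_process ::
  "'v set set \<Rightarrow> 'v policy \<Rightarrow> 'v list \<Rightarrow> nat \<Rightarrow> ('v \<times> real) stream \<Rightarrow> 'v list" where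
  "queue_process \<H> \<Phi> w 0 \<omega> = w"
| "queue_process \<H> \<Phi> w (Suc n) \<omega> = arrival_step \<H> \<Phi> (queue_process \<H> \<Phi> w n \<omega>) (\<omega> !! n)"

definition class_distributions :: "'v set \<Rightarrow> 'v pmf set" where
  "class_distributions V = {\<mu>. set_pmf \<mu> = V}"

text \<open>I.i.d. pairs of a class with law \<open>\<mu>\<close> and an independent uniform draw on the unit
  interval. Restricting \<open>\<mu>\<close> to its (finite) support makes the queue process
  measurable also when the type of nodes is uncountable.\<close>

definition input_space :: "'v pmf \<Rightarrow> ('v \<times> real) stream measure" where
  "input_space \<mu> = stream_space
     (restrict_space (measure_pmf \<mu>) (set_pmf \<mu>) \<Otimes>\<^sub>M uniform_measure lborel {0..1})"

text \<open>The time of first return to \<open>w\<close> is \<open>\<infinity>\<close> (the infimum of the empty set) if there is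
  no return.\<close>

definition return_time ::
  "'v set set \<Rightarrow> 'v policy \<Rightarrow> 'v list \<Rightarrow> ('v \<times> real) stream \<Rightarrow> enat" where
  "return_time \<H> \<Phi> w \<omega> = (INF n\<in>{n. n \<ge> 1 \<and> queue_process \<H> \<Phi> w n \<omega> = w}. enat n)"

text \<open>Positive recurrence of $(W_n)$: every state has a finite expected return time.\<close>

definition stable :: "'v set \<Rightarrow> 'v set set \<Rightarrow> 'v policy \<Rightarrow> 'v pmf \<Rightarrow> bool" where
  "stable V \<H> \<Phi> \<mu> \<longleftrightarrow>
     (\<forall>w\<in>queue_details V \<H>.
        (\<integral>\<^sup>+ \<omega>. ennreal_of_enat (return_time \<H> \<Phi> w \<omega>) \<partial>input_space \<mu>) < \<infinity>)"

definition Stab :: "'v set \<Rightarrow> 'v set set \<Rightarrow> 'v policy \<Rightarrow> 'v pmf set" where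
  "Stab V \<H> \<Phi> = {\<mu> \<in> class_distributions V. stable V \<H> \<Phi> \<mu>}"

definition non_stabilizable :: "'v set \<Rightarrow> 'v set set \<Rightarrow> bool" where
  "non_stabilizable V \<H> \<longleftrightarrow> (\<forall>\<Phi>. admissible V \<H> \<Phi> \<longrightarrow> Stab V \<H> \<Phi> = {})"

end

theory Submission imports Defs begin

text \<open>
  Under the two hypotheses there is a node \<open>j\<close> of \<open>B\<close> such that every hyperedge through
  \<open>j\<close> has a node of degree 1 other than \<open>j\<close>: take \<open>j\<close> in \<open>B\<close> on the hyperedge that has a
  node of degree 1 outside \<open>B\<close>. Give \<open>j\<close> the weight 1, one such node of each
  hyperedge through \<open>j\<close> the weight -1, and all other nodes the weight 0. A node of degree 1
  lies on a single hyperedge, so the weights of each hyperedge sum to 0. Hence the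
  items that leave in a match, whatever the policy, have total weight 0, and the weight of the
  queue is a sum of i.i.d. weights of arriving items, that is, a
  lazy nearest-neighbour random walk on the integers that moves in both directions with positive
  probability. This is \<open>queue_weight_eq_partial_sum\<close>.

  Whenever the queue is empty its weight is 0, so the empty queue cannot recur before the
  walk is back at 0. No such walk returns to 0 in finite expected time
  (\<open>expected_return_time_infinite\<close>): up to a reflection the drift is nonnegative, and then the
  walk started at 1 and killed at 0 keeps an expected position of at least 1. Its position after
  \<open>n\<close> steps is at most \<open>n + 1\<close>, so it is still alive with
  probability at least \<open>1 / (n + 1)\<close>, and the harmonic series diverges. This treats the case
  without drift, where the walk is null recurrent, together with the transient case. So
  the empty queue has an infinite expected return time, for every policy and every distribution
  of the classes.
\<close>

section \<open>Lazy walks on the integers\<close>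

definition partial_sum :: "('a \<Rightarrow> int) \<Rightarrow> 'a stream \<Rightarrow> nat \<Rightarrow> int" where
  "partial_sum s \<omega> n = (\<Sum>i<n. s (\<omega> !! i))"

lemma partial_sum_0 [simp]: "partial_sum s \<omega> 0 = 0"
  by (simp add: partial_sum_def)

lemma partial_sum_Suc: "partial_sum s \<omega> (Suc n) = partial_sum s \<omega> n + s (\<omega> !! n)"
  by (simp add: partial_sum_def)

lemma partial_sum_Suc_Stream: "partial_sum s (y ## \<omega>) (Suc n) = s y + partial_sum s \<omega> n"
  unfolding partial_sum_def by (subst sum.lessThan_Suc_shift) simp

lemma partial_sum_uminus: "partial_sum (\<lambda>y. - s y) \<omega> n = - partial_sum s \<omega> n"
  by (simp add: partial_sum_def sum_negf)

lemma partial_sum_measurable: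
  assumes [measurable]: "s \<in> M \<rightarrow>\<^sub>M count_space UNIV"
  shows "(\<lambda>\<omega>. partial_sum s \<omega> n) \<in> stream_space M \<rightarrow>\<^sub>M count_space UNIV"
proof (induction n)
  case (Suc n)
  note this [measurable]
  show ?case unfolding partial_sum_Suc by measurable
qed simp

definition stays_positive :: "('a \<Rightarrow> int) \<Rightarrow> int \<Rightarrow> nat \<Rightarrow> 'a stream \<Rightarrow> bool" where
  "stays_positive s x n \<omega> \<longleftrightarrow> (\<forall>k\<le>n. 0 < x + partial_sum s \<omega> k)"

lemma stays_positive_measurable:
  assumes "s \<in> M \<rightarrow>\<^sub>M count_space UNIV"
  shows "{\<omega> \<in> space (stream_space M). stays_positive s x n \<omega>} \<in> sets (stream_space M)"
  unfolding stays_positive_def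
proof (intro sets.sets_Collect_countable_All sets.sets_Collect_imp)
  fix k
  have "Measurable.pred (stream_space M) (\<lambda>\<omega>. 0 < x + partial_sum s \<omega> k)"
    by (rule measurable_compose[OF partial_sum_measurable[OF assms]]) simp
  then show "{\<omega> \<in> space (stream_space M). 0 < x + partial_sum s \<omega> k} \<in> sets (stream_space M)"
    by (simp only: pred_def)
  show "{\<omega> \<in> space (stream_space M). k \<le> n} \<in> sets (stream_space M)"
    by (rule sets.sets_Collect_const)
qed

text \<open>First-step decomposition: after its first step the walk from \<open>x\<close> is a walk from
  \<open>x + s y\<close> driven by the remaining steps.\<close>

lemma stays_positive_Suc_Stream:
  "stays_positive s x (Suc n) (y ## \<omega>) \<longleftrightarrow> 0 < x \<and> stays_positive s (x + s y) n \<omega>"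
proof -
  have "(\<forall>k\<le>Suc n. P k) \<longleftrightarrow> P 0 \<and> (\<forall>k\<le>n. P (Suc k))" for P
    by (metis Suc_le_mono not0_implies_Suc zero_le)
  then show ?thesis
    unfolding stays_positive_def by (simp add: partial_sum_Suc_Stream add.assoc)
qed

text \<open>A walk with nonnegative drift that is killed when it hits 0 is a submartingale:
  killing at 0 costs nothing, and steps of size at most 1 cannot jump over 0, so that a
  position at which the walk is alive has only nonnegative successors.\<close>

lemma (in prob_space) stopped_walk_expectation_ge:
  assumes s [measurable]: "s \<in> M \<rightarrow>\<^sub>M count_space UNIV"
    and steps: "\<And>y. s y \<in> {-1, 0, 1}"
    and drift: "0 \<le> expectation (\<lambda>y. real_of_int (s y))"
    and x: "0 \<le> x"
  shows "ennreal (real_of_int x) \<le> (\<integral>\<^sup>+\<omega>. (if stays_positive s x n \<omega>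
           then ennreal (real_of_int (x + partial_sum s \<omega> n)) else 0) \<partial>stream_space M)"
  using x
proof (induction n arbitrary: x)
  case 0
  interpret S: prob_space "stream_space M" by (rule prob_space_stream_space)
  have "(\<integral>\<^sup>+\<omega>. (if stays_positive s x 0 \<omega>
           then ennreal (real_of_int (x + partial_sum s \<omega> 0)) else 0) \<partial>stream_space M)
        = (\<integral>\<^sup>+\<omega>. ennreal (real_of_int x) \<partial>stream_space M)"
    using 0 by (intro nn_integral_cong) (auto simp: stays_positive_def)
  also have "\<dots> = ennreal (real_of_int x)"
    by (simp add: S.emeasure_space_1)
  finally show ?case by (rule eq_refl[OF sym])
next
  case (Suc n)
  show ?case
  proof (cases "x = 0")
    case True
    then show ?thesis by (simp only: of_int_0 ennreal_0 zero_le)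
  next
    case False
    with Suc.prems have x: "0 < x" by simp
    then have nonneg: "0 \<le> x + s y" for y
      using steps[of y] by auto
    have "\<bar>s y\<bar> \<le> 1" for y
      using steps[of y] by auto
    then have "\<bar>real_of_int (s y)\<bar> \<le> 1" for y
      by (metis of_int_abs of_int_le_1_iff)
    then have int: "integrable M (\<lambda>y. real_of_int (s y))"
      by (intro integrable_const_bound[where B = 1]) simp_all
    have "ennreal (real_of_int x) \<le> ennreal (expectation (\<lambda>y. real_of_int (x + s y)))"
      using drift int by (intro ennreal_leI) (simp add: prob_space)
    also have "\<dots> = (\<integral>\<^sup>+y. ennreal (real_of_int (x + s y)) \<partial>M)"
    proof (intro nn_integral_eq_integral[symmetric] AE_I2)
      show "integrable M (\<lambda>y. real_of_int (x + s y))" using int by simp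
      show "0 \<le> real_of_int (x + s y)" for y using nonneg by (simp only: of_int_0_le_iff)
    qed
    also have "\<dots> \<le> (\<integral>\<^sup>+y. (\<integral>\<^sup>+\<omega>. (if stays_positive s (x + s y) n \<omega>
           then ennreal (real_of_int ((x + s y) + partial_sum s \<omega> n)) else 0) \<partial>stream_space M) \<partial>M)"
      by (intro nn_integral_mono Suc.IH nonneg)
    also have "\<dots> = (\<integral>\<^sup>+y. (\<integral>\<^sup>+\<omega>. (if stays_positive s x (Suc n) (y ## \<omega>)
           then ennreal (real_of_int (x + partial_sum s (y ## \<omega>) (Suc n))) else 0) \<partial>stream_space M) \<partial>M)"
      using x by (simp add: partial_sum_Suc_Stream stays_positive_Suc_Stream add.assoc cong: if_cong)
    also have "\<dots> = (\<integral>\<^sup>+\<omega>. (if stays_positive s x (Suc n) \<omega>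
           then ennreal (real_of_int (x + partial_sum s \<omega> (Suc n))) else 0) \<partial>stream_space M)"
    proof (rule nn_integral_stream_space[symmetric])
      note [measurable] = partial_sum_measurable[OF s, of "Suc n"] stays_positive_measurable[OF s, of x "Suc n"]
      show "(\<lambda>\<omega>. if stays_positive s x (Suc n) \<omega>
          then ennreal (real_of_int (x + partial_sum s \<omega> (Suc n))) else 0)
        \<in> borel_measurable (stream_space M)"
        by measurable
    qed
    finally show ?thesis .
  qed
qed

text \<open>The expectation of the killed walk started at 1 is at least 1, while its position after \<open>n\<close>
  steps is at most \<open>n + 1\<close>: the mass that carries this expectation cannot be smaller than the
  quotient.\<close>

lemma (in prob_space) emeasure_stays_positive_ge:
  assumes s [measurable]: "s \<in> M \<rightarrow>\<^sub>M count_space UNIV"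
    and steps: "\<And>y. s y \<in> {-1, 0, 1}"
    and drift: "0 \<le> expectation (\<lambda>y. real_of_int (s y))"
  shows "ennreal (1 / real (Suc n))
    \<le> emeasure (stream_space M) {\<omega> \<in> space (stream_space M). stays_positive s 1 n \<omega>}"
    (is "_ \<le> ?p")
proof -
  have bound: "partial_sum s \<omega> n \<le> int n" for \<omega>
  proof (induction n)
    case (Suc n)
    then show ?case using steps[of "\<omega> !! n"] by (auto simp: partial_sum_Suc)
  qed simp
  have "1 \<le> (\<integral>\<^sup>+\<omega>. (if stays_positive s 1 n \<omega>
           then ennreal (real_of_int (1 + partial_sum s \<omega> n)) else 0) \<partial>stream_space M)"
    using stopped_walk_expectation_ge[OF s steps drift, of 1 n] by simp
  also have "\<dots> \<le> (\<integral>\<^sup>+\<omega>. ennreal (real (Suc n))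
           * indicator {\<omega> \<in> space (stream_space M). stays_positive s 1 n \<omega>} \<omega> \<partial>stream_space M)"
  proof (intro nn_integral_mono)
    fix \<omega>
    assume "\<omega> \<in> space (stream_space M)"
    moreover have "real_of_int (1 + partial_sum s \<omega> n) \<le> real (Suc n)"
      using bound[of \<omega>] by linarith
    ultimately show "(if stays_positive s 1 n \<omega> then ennreal (real_of_int (1 + partial_sum s \<omega> n)) else 0)
      \<le> ennreal (real (Suc n))
        * indicator {\<omega> \<in> space (stream_space M). stays_positive s 1 n \<omega>} \<omega>"
      by (auto simp: indicator_def simp del: of_nat_Suc of_int_add intro: ennreal_leI)
  qed
  also have "\<dots> = ennreal (real (Suc n)) * ?p"
    by (rule nn_integral_cmult_indicator[OF stays_positive_measurable[OF s]])
  finally have "ennreal (1 / real (Suc n)) * 1 \<le> ennreal (1 / real (Suc n)) * (ennreal (real (Suc n)) * ?p)"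
    by (rule mult_left_mono) simp
  also have "\<dots> = ?p"
    by (simp add: mult.assoc[symmetric] ennreal_mult[symmetric] del: of_nat_Suc)
  finally show ?thesis by simp
qed

text \<open>The time \<open>T\<close> may be any time at which the walk is at 0, not only the first
  one, because it will be the return time of a process of which the walk is a mere functional. It
  exceeds \<open>n\<close> whenever the walk steps up to 1 and then stays positive for \<open>n\<close> steps. Summing the
  probabilities of these events over \<open>n\<close> bounds the expectation of \<open>T\<close> from below by a multiple of
  the harmonic series.\<close>

lemma (in prob_space) expected_return_time_infinite_if_drift_nonneg:
  assumes s [measurable]: "s \<in> M \<rightarrow>\<^sub>M count_space UNIV"
    and steps: "\<And>y. s y \<in> {-1, 0, 1}"
    and drift: "0 \<le> expectation (\<lambda>y. real_of_int (s y))"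
    and up: "emeasure M {y \<in> space M. s y = 1} \<noteq> 0"
    and T: "\<And>\<omega> n. \<omega> \<in> space (stream_space M) \<Longrightarrow> T \<omega> = enat n \<Longrightarrow>
              1 \<le> n \<and> partial_sum s \<omega> n = 0"
  shows "(\<integral>\<^sup>+\<omega>. ennreal_of_enat (T \<omega>) \<partial>stream_space M) = \<infinity>"
proof -
  define E where "E n = {\<omega> \<in> space (stream_space M). s (\<omega> !! 0) = 1 \<and> stays_positive s 1 n (stl \<omega>)}" for n
  have E_sets [measurable]: "E n \<in> sets (stream_space M)" for n
  proof -
    have "Measurable.pred (stream_space M) (\<lambda>\<omega>. s (\<omega> !! 0) = 1)" by measurable
    moreover have "Measurable.pred (stream_space M) (\<lambda>\<omega>. stays_positive s 1 n (stl \<omega>))"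
      using stays_positive_measurable[OF s, folded pred_def] by (rule measurable_compose[OF measurable_stl])
    ultimately show ?thesis unfolding E_def pred_def by (intro sets.sets_Collect_conj)
  qed
  define p where "p = emeasure M {y \<in> space M. s y = 1}"
  have E_prob: "p * ennreal (1 / real (Suc n)) \<le> emeasure (stream_space M) (E n)" for n
  proof -
    let ?Q = "{\<omega> \<in> space (stream_space M). stays_positive s 1 n \<omega>}"
    have "p * ennreal (1 / real (Suc n)) \<le> p * emeasure (stream_space M) ?Q"
      by (intro mult_left_mono emeasure_stays_positive_ge s steps drift) simp
    also have "\<dots> = (\<integral>\<^sup>+y. emeasure (stream_space M) ?Q * indicator {y \<in> space M. s y = 1} y \<partial>M)"
      by (subst nn_integral_cmult_indicator) (simp_all add: p_def mult.commute)
    also have "\<dots> \<le> (\<integral>\<^sup>+y. emeasure (stream_space M) {\<omega> \<in> space (stream_space M). y ## \<omega> \<in> E n} \<partial>M)"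
    proof (intro nn_integral_mono)
      fix y
      assume "y \<in> space M"
      then have "?Q = {\<omega> \<in> space (stream_space M). y ## \<omega> \<in> E n}" if "s y = 1"
        using that by (auto simp: E_def space_stream_space streams_Stream)
      then show "emeasure (stream_space M) ?Q * indicator {y \<in> space M. s y = 1} y
          \<le> emeasure (stream_space M) {\<omega> \<in> space (stream_space M). y ## \<omega> \<in> E n}"
        by (cases "s y = 1") (simp_all add: indicator_def)
    qed
    also have "\<dots> = emeasure (stream_space M) (E n)"
      by (rule emeasure_stream_space[symmetric]) measurable
    finally show ?thesis .
  qed
  have "(\<Sum>n. indicator (E n) \<omega>) \<le> ennreal_of_enat (T \<omega>)" if \<omega>: "\<omega> \<in> space (stream_space M)" for \<omega>
  proof (cases "T \<omega>")
    case (enat t)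
    with T[OF \<omega>, of t] have t: "1 \<le> t" "partial_sum s \<omega> t = 0" by auto
    have "n < t" if "\<omega> \<in> E n" for n
    proof (rule ccontr)
      assume "\<not> n < t"
      then have "0 < 1 + partial_sum s (stl \<omega>) (t - 1)"
        using that by (auto simp: E_def stays_positive_def)
      moreover have "partial_sum s \<omega> t = s (\<omega> !! 0) + partial_sum s (stl \<omega>) (t - 1)"
        using partial_sum_Suc_Stream[of s "shd \<omega>" "stl \<omega>" "t - 1"] t(1) by simp
      ultimately show False using t(2) that by (simp add: E_def)
    qed
    then have "(\<Sum>n<N. indicator (E n) \<omega>) \<le> (of_nat t :: ennreal)" for N
    proof -
      have "(\<Sum>n<N. indicator (E n) \<omega>) = (of_nat (card {n \<in> {..<N}. \<omega> \<in> E n}) :: ennreal)"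
        by (simp add: indicator_def sum.If_cases Int_def)
      also have "\<dots> \<le> of_nat (card {..<t})"
        using \<open>\<And>n. \<omega> \<in> E n \<Longrightarrow> n < t\<close> by (intro of_nat_mono card_mono) auto
      finally show ?thesis by simp
    qed
    then show ?thesis using enat by (intro suminf_le_const) auto
  qed simp
  then have "(\<integral>\<^sup>+\<omega>. (\<Sum>n. indicator (E n) \<omega>) \<partial>stream_space M)
      \<le> (\<integral>\<^sup>+\<omega>. ennreal_of_enat (T \<omega>) \<partial>stream_space M)"
    by (rule nn_integral_mono)
  moreover have "(\<integral>\<^sup>+\<omega>. (\<Sum>n. indicator (E n) \<omega>) \<partial>stream_space M)
      = (\<Sum>n. emeasure (stream_space M) (E n))"
    by (subst nn_integral_suminf) simp_all
  moreover have "p * (\<Sum>n. ennreal (1 / real (Suc n))) \<le> (\<Sum>n. emeasure (stream_space M) (E n))"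
    unfolding ennreal_suminf_cmult[symmetric] by (intro suminf_le E_prob) auto
  moreover have "(\<Sum>n. ennreal (1 / real (Suc n))) = top"
    using not_summable_harmonic[where 'a = real] summable_Suc_iff[where f = "\<lambda>n. 1 / real n"]
    by (intro summable_iff_suminf_neq_top) (auto simp: inverse_eq_divide)
  ultimately show ?thesis
    using up by (auto simp: p_def ennreal_mult_top top_unique)
qed

text \<open>Reflecting the walk reverses the sign of its drift, so a drift of either sign is covered
  as long as both directions have positive probability.\<close>

lemma (in prob_space) expected_return_time_infinite:
  assumes s [measurable]: "s \<in> M \<rightarrow>\<^sub>M count_space UNIV"
    and steps: "\<And>y. s y \<in> {-1, 0, 1}"
    and up: "emeasure M {y \<in> space M. s y = 1} \<noteq> 0"
    and down: "emeasure M {y \<in> space M. s y = -1} \<noteq> 0"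
    and T: "\<And>\<omega> n. \<omega> \<in> space (stream_space M) \<Longrightarrow> T \<omega> = enat n \<Longrightarrow>
              1 \<le> n \<and> partial_sum s \<omega> n = 0"
  shows "(\<integral>\<^sup>+\<omega>. ennreal_of_enat (T \<omega>) \<partial>stream_space M) = \<infinity>"
proof (cases "0 \<le> expectation (\<lambda>y. real_of_int (s y))")
  case True
  then show ?thesis
    using expected_return_time_infinite_if_drift_nonneg[OF s steps _ up T] by blast
next
  case False
  show ?thesis
  proof (rule expected_return_time_infinite_if_drift_nonneg[where s = "\<lambda>y. - s y"])
    show "- s y \<in> {-1, 0, 1}" for y using steps[of y] by auto
    show "0 \<le> expectation (\<lambda>y. real_of_int (- s y))" using False by simp
    have "- s y = 1 \<longleftrightarrow> s y = -1" for y by linarith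
    then show "emeasure M {y \<in> space M. - s y = 1} \<noteq> 0" using down by simp
    show "1 \<le> n \<and> partial_sum (\<lambda>y. - s y) \<omega> n = 0"
      if "\<omega> \<in> space (stream_space M)" "T \<omega> = enat n" for \<omega> n
      using T[OF that] by (simp add: partial_sum_uminus)
  qed measurable
qed


section \<open>Weights conserved by the matches\<close>

lemma sum_list_map_nths:
  fixes g :: "'a \<Rightarrow> int"
  shows "sum_list (map g (nths w I)) = (\<Sum>i | i < length w \<and> i \<in> I. g (w ! i))"
proof (induction w rule: rev_induct)
  case (snoc c w)
  have "{i. i < length (w @ [c]) \<and> i \<in> I} =
      {i. i < length w \<and> i \<in> I} \<union> (if length w \<in> I then {length w} else {})"
    by (auto simp: less_Suc_eq)
  moreover have "(\<Sum>i | i < length w \<and> i \<in> I. g ((w @ [c]) ! i)) = (\<Sum>i | i < length w \<and> i \<in> I. g (w ! i))"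
    by (intro sum.cong) (auto simp: nth_append)
  ultimately show ?case using snoc by (simp add: nths_append)
qed simp

lemma sum_list_map_nths_Compl:
  fixes g :: "'a \<Rightarrow> int"
  assumes "S \<subseteq> {..<length w}"
  shows "sum_list (map g (nths w (- S))) = sum_list (map g w) - (\<Sum>i\<in>S. g (w ! i))"
proof -
  have "sum_list (map g w) = (\<Sum>i<length w. g (w ! i))"
    by (simp add: sum_list_sum_nth atLeast0LessThan)
  also have "\<dots> = (\<Sum>i\<in>{..<length w} - S. g (w ! i)) + (\<Sum>i\<in>S. g (w ! i))"
    using assms by (intro sum.subset_diff) auto
  also have "{..<length w} - S = {i. i < length w \<and> i \<in> - S}" by auto
  finally show ?thesis by (simp add: sum_list_map_nths)
qed

text \<open>The matched items and the incoming item form a hyperedge, of total weight 0, so removing the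
  former from the queue adds the weight of the latter.\<close>

lemma match_removes_incoming_weight:
  fixes g :: "'v \<Rightarrow> int"
  assumes balanced: "\<forall>h\<in>\<H>. sum g h = 0"
    and S: "S \<in> possible_matches \<H> w c"
  shows "sum_list (map g (nths w (- S))) = sum_list (map g w) + g c"
proof -
  let ?A = "(!) w ` S"
  from S have S': "S \<subseteq> {..<length w}" "inj_on ((!) w) S" "c \<notin> ?A" "insert c ?A \<in> \<H>"
    by (auto simp: possible_matches_def)
  then have "finite ?A" by (auto intro: finite_subset)
  then have "g c + sum g ?A = 0" using balanced S' by (metis sum.insert)
  moreover have "sum g ?A = (\<Sum>i\<in>S. g (w ! i))" using S' by (simp add: sum.reindex)
  ultimately show ?thesis using S' by (simp add: sum_list_map_nths_Compl)
qed

text \<open>Choosing one stored item per class turns a hyperedge of available classes into a match. So an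
  item is only stored when the queue then still contains no hyperedge.\<close>

lemma possible_matches_nonempty:
  assumes "h \<in> \<H>" "c \<in> h" "h \<subseteq> insert c (set w)"
  shows "possible_matches \<H> w c \<noteq> {}"
proof -
  define pos where "pos v = (SOME i. i < length w \<and> w ! i = v)" for v
  have pos: "pos v < length w \<and> w ! pos v = v" if "v \<in> h - {c}" for v
    unfolding pos_def by (rule someI_ex) (use that assms in \<open>auto simp: in_set_conv_nth\<close>)
  then have image: "(!) w ` pos ` (h - {c}) = h - {c}"
    by (force simp: image_image)
  have "inj_on ((!) w) (pos ` (h - {c}))"
    by (rule inj_onI) (metis imageE pos)
  with pos image assms show ?thesis
    by (auto simp: possible_matches_def insert_absorb intro!: exI[of _ "pos ` (h - {c})"])
qed

text \<open>Storing the incoming item and matching it have the same effect on the weight.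
  Membership in \<open>queue_details\<close> goes along, because the choices of an admissible policy are only
  known to be possible matches there.\<close>

lemma arrival_step_preserves:
  fixes g :: "'v \<Rightarrow> int"
  assumes adm: "admissible V \<H> \<Phi>"
    and balanced: "\<forall>h\<in>\<H>. sum g h = 0"
    and w: "w \<in> queue_details V \<H>" and c: "c \<in> V"
  shows "arrival_step \<H> \<Phi> w (c, u) \<in> queue_details V \<H>"
    and "sum_list (map g (arrival_step \<H> \<Phi> w (c, u))) = sum_list (map g w) + g c"
proof -
  have "arrival_step \<H> \<Phi> w (c, u) \<in> queue_details V \<H> \<and>
    sum_list (map g (arrival_step \<H> \<Phi> w (c, u))) = sum_list (map g w) + g c"
  proof (cases "possible_matches \<H> w c = {}")
    case True
    have "\<not> h \<subseteq> set (w @ [c])" if "h \<in> \<H>" for h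
    proof
      assume "h \<subseteq> set (w @ [c])"
      moreover from this have "c \<in> h" using w that by (auto simp: queue_details_def)
      ultimately show False using possible_matches_nonempty[OF that, of c w] True by auto
    qed
    then show ?thesis
      using True w c by (auto simp: arrival_step_def queue_details_def)
  next
    case False
    then have "\<Phi> w c \<in> borel \<rightarrow>\<^sub>M count_space (possible_matches \<H> w c)"
      using adm w c unfolding admissible_def by blast
    from measurable_space[OF this, of u] have S: "\<Phi> w c u \<in> possible_matches \<H> w c"
      by simp
    have "set (nths w (- \<Phi> w c u)) \<subseteq> set w" by (rule set_nths_subset)
    then have "nths w (- \<Phi> w c u) \<in> queue_details V \<H>"
      using w by (force simp: queue_details_def)
    then show ?thesis
      using False match_removes_incoming_weight[OF balanced S] by (simp add: arrival_step_def)
  qed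
  then show "arrival_step \<H> \<Phi> w (c, u) \<in> queue_details V \<H>"
    and "sum_list (map g (arrival_step \<H> \<Phi> w (c, u))) = sum_list (map g w) + g c" by auto
qed

lemma queue_weight_eq_partial_sum:
  fixes g :: "'v \<Rightarrow> int"
  assumes adm: "admissible V \<H> \<Phi>"
    and balanced: "\<forall>h\<in>\<H>. sum g h = 0"
    and w: "w \<in> queue_details V \<H>"
    and \<omega>: "\<And>k. fst (\<omega> !! k) \<in> V"
  shows "sum_list (map g (queue_process \<H> \<Phi> w n \<omega>)) =
    sum_list (map g w) + partial_sum (g \<circ> fst) \<omega> n"
proof -
  have "queue_process \<H> \<Phi> w n \<omega> \<in> queue_details V \<H> \<and>
    sum_list (map g (queue_process \<H> \<Phi> w n \<omega>)) = sum_list (map g w) + partial_sum (g \<circ> fst) \<omega> n"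
  proof (induction n)
    case (Suc n)
    obtain c u where cu: "\<omega> !! n = (c, u)" by fastforce
    with \<omega>[of n] have "c \<in> V" by simp
    with Suc arrival_step_preserves[OF adm balanced, of "queue_process \<H> \<Phi> w n \<omega>" c u] cu
    show ?case by (simp add: partial_sum_Suc)
  qed (use w in simp)
  then show ?thesis by simp
qed

lemma return_time_eq_enatD:
  assumes "return_time \<H> \<Phi> w \<omega> = enat n"
  shows "1 \<le> n \<and> queue_process \<H> \<Phi> w n \<omega> = w"
proof -
  let ?A = "{n. n \<ge> 1 \<and> queue_process \<H> \<Phi> w n \<omega> = w}"
  have "return_time \<H> \<Phi> w \<omega> = \<infinity>" if "?A = {}"
    unfolding return_time_def that by (simp add: top_enat_def)
  then obtain k where "k \<in> ?A" using assms by fastforce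
  then have "Inf (enat ` ?A) \<in> enat ` ?A" by (intro wellorder_InfI[OF imageI])
  then have "enat n \<in> enat ` ?A" using assms by (simp only: return_time_def)
  then show ?thesis by auto
qed


section \<open>Non-stabilizability\<close>

text \<open>The weight of the queue is a walk driven by the arrivals alone; it vanishes when the
  queue is empty, and the nodes \<open>a\<close> and \<open>b\<close> make both directions possible. So the return time of the
  empty queue has infinite expectation.\<close>

theorem non_stabilizable_if_balanced_weight:
  fixes g :: "'v \<Rightarrow> int"
  assumes edges: "{} \<notin> \<H>"
    and range: "\<And>v. g v \<in> {-1, 0, 1}"
    and balanced: "\<forall>h\<in>\<H>. sum g h = 0"
    and a: "a \<in> V" "g a = 1" and b: "b \<in> V" "g b = -1"
  shows "non_stabilizable V \<H>"
  unfolding non_stabilizable_def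
proof (intro allI impI equals0I)
  fix \<Phi> \<mu>
  assume adm: "admissible V \<H> \<Phi>" and "\<mu> \<in> Stab V \<H> \<Phi>"
  then have supp: "set_pmf \<mu> = V" and st: "stable V \<H> \<Phi> \<mu>"
    by (auto simp: Stab_def class_distributions_def)
  let ?C = "restrict_space (measure_pmf \<mu>) (set_pmf \<mu>)"
  let ?U = "uniform_measure lborel {0..1::real}"
  let ?M = "?C \<Otimes>\<^sub>M ?U"
  interpret C: prob_space ?C
    by (intro prob_space_restrict_space measure_pmf.emeasure_eq_1_AE) (auto simp: AE_measure_pmf)
  interpret U: prob_space ?U by (intro prob_space_uniform_measure) auto
  interpret CU: pair_prob_space ?C ?U ..
  have space_M: "space ?M = V \<times> UNIV"
    by (simp add: space_pair_measure space_restrict_space supp)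
  have "g \<in> ?C \<rightarrow>\<^sub>M count_space UNIV" by (intro measurable_restrict_space1) simp
  then have g: "g \<circ> fst \<in> ?M \<rightarrow>\<^sub>M count_space UNIV" by (rule measurable_comp[OF measurable_fst])
  have charged: "emeasure ?M {y \<in> space ?M. (g \<circ> fst) y = z} \<noteq> 0" if v: "v \<in> V" "g v = z" for v z
  proof -
    have "emeasure ?M ({v} \<times> UNIV) = emeasure ?C {v} * emeasure ?U UNIV"
      by (intro U.emeasure_pair_measure_Times) (use v supp in \<open>auto simp: sets_restrict_space\<close>)
    also have "emeasure ?C {v} = emeasure \<mu> {v}"
      using v supp by (intro emeasure_restrict_space) auto
    also have "emeasure ?U UNIV = 1" using U.emeasure_space_1 by simp
    finally have "emeasure ?M ({v} \<times> UNIV) = ennreal (pmf \<mu> v)"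
      by (simp add: emeasure_pmf_single)
    moreover have "pmf \<mu> v \<noteq> 0"
      using v(1) unfolding supp[symmetric] set_pmf_iff .
    ultimately have "emeasure ?M ({v} \<times> UNIV) \<noteq> 0"
      by simp
    moreover have "emeasure ?M ({v} \<times> UNIV) \<le> emeasure ?M {y \<in> space ?M. (g \<circ> fst) y = z}"
    proof (rule emeasure_mono)
      show "{v} \<times> UNIV \<subseteq> {y \<in> space ?M. (g \<circ> fst) y = z}"
        using v unfolding space_M by auto
      show "{y \<in> space ?M. (g \<circ> fst) y = z} \<in> sets ?M"
        using measurable_sets[OF g, of "{z}"] by (simp add: vimage_def Int_def conj_commute)
    qed
    ultimately show ?thesis by auto
  qed
  have nil: "[] \<in> queue_details V \<H>" using edges by (auto simp: queue_details_def)
  have "(\<integral>\<^sup>+\<omega>. ennreal_of_enat (return_time \<H> \<Phi> [] \<omega>) \<partial>input_space \<mu>) = \<infinity>"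
    unfolding input_space_def
  proof (rule CU.expected_return_time_infinite[where s = "g \<circ> fst"])
    show "g \<circ> fst \<in> ?M \<rightarrow>\<^sub>M count_space UNIV" by (rule g)
    show "(g \<circ> fst) y \<in> {-1, 0, 1}" for y using range by simp
    show "emeasure ?M {y \<in> space ?M. (g \<circ> fst) y = 1} \<noteq> 0" using charged a by blast
    show "emeasure ?M {y \<in> space ?M. (g \<circ> fst) y = -1} \<noteq> 0" using charged b by blast
  next
    fix \<omega> n
    assume \<omega>: "\<omega> \<in> space (stream_space ?M)" and n: "return_time \<H> \<Phi> [] \<omega> = enat n"
    have "fst (\<omega> !! k) \<in> V" for k
      using \<omega> unfolding space_stream_space space_M streams_iff_snth by (simp add: mem_Times_iff)
    then show "1 \<le> n \<and> partial_sum (g \<circ> fst) \<omega> n = 0"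
      using return_time_eq_enatD[OF n] queue_weight_eq_partial_sum[OF adm balanced nil, of \<omega> n] by simp
  qed
  with st nil show False by (auto simp: stable_def)
qed

theorem proposition4p6:
  fixes V :: "'v set" and \<H> :: "'v set set" and B :: "'v set"
  assumes "hypergraph V \<H>"
    and "simple_hypergraph \<H>"
    and "connected_hypergraph \<H>"
    and "B \<subseteq> V"
    and "\<forall>h\<in>hyperedges_meeting \<H> B. \<exists>i\<in>h. node_degree \<H> i = 1"
    and "\<exists>h\<in>hyperedges_meeting \<H> B. \<exists>i\<in>h. node_degree \<H> i = 1 \<and> i \<notin> B"
  shows "non_stabilizable V \<H>"
proof -
  from assms(6) obtain h0 i0 where h0: "h0 \<in> \<H>" "h0 \<inter> B \<noteq> {}" and i0: "i0 \<in> h0" "node_degree \<H> i0 = 1" "i0 \<notin> B"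
    by (auto simp: hyperedges_meeting_def)
  from h0 obtain j where j: "j \<in> h0" "j \<in> B" by blast
  with i0 have "j \<noteq> i0" by auto
  have unique: "h = h'" if "node_degree \<H> i = 1" "h \<in> \<H>" "h' \<in> \<H>" "i \<in> h" "i \<in> h'" for h h' i
    using that by (auto simp: node_degree_def card_1_singleton_iff)
  \<comment> \<open>If \<open>j\<close> itself is the node of degree 1 on \<open>h\<close>, then \<open>h = h0\<close>, and \<open>i0\<close> is another one.\<close>
  have "\<exists>i. i \<in> h \<and> node_degree \<H> i = 1 \<and> i \<noteq> j" if "h \<in> \<H>" "j \<in> h" for h
  proof -
    from that j assms(5) obtain i where i: "i \<in> h" "node_degree \<H> i = 1"
      by (auto simp: hyperedges_meeting_def)
    show ?thesis
    proof (cases "i = j")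
      case True
      then have "h = h0" using unique i that h0 j by blast
      then show ?thesis using i0 \<open>j \<noteq> i0\<close> by blast
    qed (use i in blast)
  qed
  then obtain r where r: "\<And>h. h \<in> \<H> \<Longrightarrow> j \<in> h \<Longrightarrow> r h \<in> h \<and> node_degree \<H> (r h) = 1 \<and> r h \<noteq> j"
    by metis
  define R where "R = r ` {h \<in> \<H>. j \<in> h}"
  define g :: "'v \<Rightarrow> int" where "g v = (if v = j then 1 else if v \<in> R then -1 else 0)" for v
  have sub: "h \<subseteq> V" if "h \<in> \<H>" for h using that assms(1) by (auto simp: hypergraph_def)
  have fin: "finite h" if "h \<in> \<H>" for h
    using sub[OF that] assms(1) by (auto simp: hypergraph_def intro: finite_subset)
  have balanced: "sum g h = 0" if h: "h \<in> \<H>" for h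
  proof (cases "j \<in> h")
    case True
    have "v = r h" if "v \<in> h" "v \<in> R" for v
      using that h unique r by (auto simp: R_def)
    then have "g v = 0" if "v \<in> h - {j, r h}" for v
      using that by (auto simp: g_def)
    then have "sum g h = sum g {j, r h}"
      using r[OF h True] True fin[OF h] by (intro sum.mono_neutral_right) auto
    also have "\<dots> = 0"
      using r[OF h True] h True by (auto simp: g_def R_def)
    finally show ?thesis .
  next
    case False
    have "v \<notin> R" if "v \<in> h" for v
    proof
      assume "v \<in> R"
      then obtain h' where "h' \<in> \<H>" "j \<in> h'" "v = r h'" by (auto simp: R_def)
      with r[of h'] unique[of v h h'] h that False show False by auto
    qed
    with False show ?thesis by (intro sum.neutral) (auto simp: g_def)
  qed
  show ?thesis
  proof (rule non_stabilizable_if_balanced_weight[where g = g and a = j and b = "r h0"])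
    show "{} \<notin> \<H>" using assms(2) h0 j by (auto simp: simple_hypergraph_def)
    show "g v \<in> {-1, 0, 1}" for v by (simp add: g_def)
    show "\<forall>h\<in>\<H>. sum g h = 0" using balanced by blast
    show "j \<in> V" "r h0 \<in> V" using sub[OF h0(1)] j r[OF h0(1) j(1)] by auto
    show "g j = 1" "g (r h0) = -1" using r[OF h0(1) j(1)] h0 j by (auto simp: g_def R_def)
  qed
qed

end
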